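(* Suppose that $A$ and $B$ are two disjoint compact, path-connected, and ortho-convex subsets of $\mathbb{R}^2$. Then there exists a staircase line strictly separating $A$ and $B$.
   Context: A set in $\mathbb{R}^2$ is ortho-convex if its intersection with every horizontal line and every vertical line is connected (possibly empty). An axis-aligned segment is a line segment parallel to one of the coordinate axes. A staircase segment is a simple polyline $v_0v_1\ldots v_n$ in $\mathbb{R}^2$ formed by axis-aligned segments such that all vectors $\overrightarrow{v_{i-1}v_i}$ with $i$ odd have the same direction, and all vectors $\overrightarrow{v_{i-1}v_i}$ with $i$ even have the same direction ($1\le i\le n$). A staircase line is a path obtained from a staircase segment $v_0v_1\ldots v_n$ by replacing the line segments $v_0v_1$ and $v_{n-1}v_n$ with the ray from $v_1$ through $v_0$ and the ray from $v_{n-1}$ through $v_n$, respectively; in particular axis-aligned lines are staircase lines. A staircase-halfplane is a closed set whose boundary is a staircase line; the two staircase-halfplanes formed by a staircase line $l$ are the closures of the two connected components of $\mathbb{R}^2\setminus l$. A staircase line separates two sets $A$ and $B$ if one of the two staircase-halfplanes formed by it contains $A$ and the other one contains $B$; it strictly separates $A$ and $B$ if, moreover, neither $A$ nor $B$ intersects the staircase line. *)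

theory Defs
  imports "HOL-Analysis.Analysis"
begin

definition ortho_convex :: "(real^2) set \<Rightarrow> bool" where
  "ortho_convex S \<longleftrightarrow>
     (\<forall>c. connected (S \<inter> {p. p $ 1 = c})) \<and> (\<forall>c. connected (S \<inter> {p. p $ 2 = c}))"

text \<open>Line segments are nondegenerate, so that edges have a direction.\<close>

definition axis_aligned :: "real^2 \<Rightarrow> real^2 \<Rightarrow> bool" where
  "axis_aligned a b \<longleftrightarrow> a \<noteq> b \<and> (a $ 1 = b $ 1 \<or> a $ 2 = b $ 2)"

text \<open>\<open>polyline v n\<close> traverses the vertices \<open>v 0, \<dots>, v n\<close> in this order. Its one-edge case
  is not built on the zero-edge case, because prepending a constant path would destroy
  injectivity, and hence \<^const>\<open>arc\<close>.\<close>

fun polyline :: "(nat \<Rightarrow> 'a::real_normed_vector) \<Rightarrow> nat \<Rightarrow> real \<Rightarrow> 'a" where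
  "polyline v 0 = linepath (v 0) (v 0)"
| "polyline v (Suc 0) = linepath (v 0) (v 1)"
| "polyline v (Suc (Suc n)) = polyline v (Suc n) +++ linepath (v (Suc n)) (v (Suc (Suc n)))"

text \<open>A nonzero vector \<open>u\<close> has direction \<open>sgn u\<close>, the unit vector \<open>u /\<^sub>R norm u\<close>.\<close>

definition staircase_segment :: "(nat \<Rightarrow> real^2) \<Rightarrow> nat \<Rightarrow> bool" where
  "staircase_segment v n \<longleftrightarrow>
     1 \<le> n \<and> arc (polyline v n) \<and>
     (\<forall>i\<in>{1..n}. axis_aligned (v (i - 1)) (v i)) \<and>
     (\<forall>i\<in>{1..n}. \<forall>j\<in>{1..n}. odd i \<and> odd j \<longrightarrow> sgn (v i - v (i - 1)) = sgn (v j - v (j - 1))) \<and>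
     (\<forall>i\<in>{1..n}. \<forall>j\<in>{1..n}. even i \<and> even j \<longrightarrow> sgn (v i - v (i - 1)) = sgn (v j - v (j - 1)))"

definition ray :: "'a::real_vector \<Rightarrow> 'a \<Rightarrow> 'a set" where
  "ray p q = {p + t *\<^sub>R (q - p) | t. 0 \<le> t}"

text \<open>For \<open>n = 1\<close> the two rays overlap and their union is the line through \<open>v 0\<close> and \<open>v 1\<close>.\<close>

definition staircase_line :: "(real^2) set \<Rightarrow> bool" where
  "staircase_line l \<longleftrightarrow>
     (\<exists>v n. staircase_segment v n \<and>
        l = ray (v 1) (v 0) \<union> (\<Union>i\<in>{1<..<n}. closed_segment (v (i - 1)) (v i)) \<union> ray (v (n - 1)) (v n))"

definition staircase_halfplanes :: "(real^2) set \<Rightarrow> (real^2) set set" where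
  "staircase_halfplanes l = closure ` components (- l)"

definition separates :: "(real^2) set \<Rightarrow> (real^2) set \<Rightarrow> (real^2) set \<Rightarrow> bool" where
  "separates l A B \<longleftrightarrow>
     (\<exists>H\<in>staircase_halfplanes l. \<exists>K\<in>staircase_halfplanes l. H \<noteq> K \<and> A \<subseteq> H \<and> B \<subseteq> K)"

definition strictly_separates :: "(real^2) set \<Rightarrow> (real^2) set \<Rightarrow> (real^2) set \<Rightarrow> bool" where
  "strictly_separates l A B \<longleftrightarrow> separates l A B \<and> A \<inter> l = {} \<and> B \<inter> l = {}"

end

theory Submission
  imports Defs
begin

text \<open>
  The four closed quadrants at a point correspond to the signs \<open>s, t\<close> in \<open>{1, -1}\<close>. The heart of the
  matter is that for some fixed signs no point of \<open>B\<close> lies in the \<open>(s, t)\<close>-quadrant of any point of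
  \<open>A\<close> (\<open>ortho_convex_sets_avoid_a_quadrant\<close>). On a vertical line that meets both sets, the sections
  of \<open>A\<close> and \<open>B\<close> are disjoint intervals, so one lies above the other. Which one it is does not change
  from line to line, because the abscissae of the two cases form disjoint closed sets covering an
  interval. The same holds for horizontal lines. Suppose that \<open>A\<close> is above \<open>B\<close> on all common vertical
  lines and to the right of \<open>B\<close> on all common horizontal lines. If some \<open>b\<close> were to the upper right
  of some \<open>a\<close>, then \<open>B\<close>, being connected, would either cross one of the two sides of the quadrant of
  \<open>a\<close>, which the order of the sections forbids, or stay inside its interior. In the latter
  case the same argument puts \<open>A\<close> into the open opposite quadrant of every point of \<open>B\<close>, and then
  no vertical line meets both sets. If the projections of the two sets to some axis are disjoint,
  their order already gives the claim.

  Now reflect so that no point of \<open>B\<close> is to the upper right of a point of \<open>A\<close>. By compactness this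
  remains true with a margin \<open>e\<close>. On a grid of vertical lines at distance \<open>e\<close>, let the line descend
  in steps, each slightly above everything in \<open>B\<close> on or to the right of the left end of the step;
  the margin keeps \<open>A\<close> above it (\<open>staircase_between\<close>). The complement of such a staircase is the
  disjoint union of two open sets, so the components containing \<open>A\<close> and \<open>B\<close> lie on different sides.
  Their closures differ because an open side misses the closure of anything on the other side
  (\<open>strictly_separates_splits\<close>).
\<close>

section \<open>A quadrant free of coincidences\<close>

lemma nonvanishing_on_connected_has_sign:
  fixes f :: "'a::topological_space \<Rightarrow> real"
  assumes "connected S" "continuous_on S f" "\<And>x. x \<in> S \<Longrightarrow> f x \<noteq> 0"
  shows "\<exists>s\<in>{1, -1}. \<forall>x\<in>S. s * f x < 0"
proof (rule ccontr)
  assume "\<not> ?thesis"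
  then obtain x y where xy: "x \<in> S" "y \<in> S" "f x \<ge> 0" "f y \<le> 0"
    by force
  have "is_interval (f ` S)"
    using assms connected_continuous_image is_interval_connected_1 by blast
  then have "0 \<in> f ` S"
    using xy unfolding is_interval_1 by blast
  then show False
    using assms(3) by auto
qed

text \<open>
  Over a single \<open>c\<close>, the coordinate difference \<open>b $ j - a $ j\<close> has no zero on the connected product of
  the two sections, hence a constant sign. The set \<open>P t\<close> of those \<open>c\<close> that exhibit a given sign is a
  projection of a compact set. So \<open>P 1\<close> and \<open>P (-1)\<close> are disjoint closed sets covering the interval
  \<open>I\<close> of common coordinates, and one of them does not meet it.
\<close>

lemma disjoint_sections_ordered_alike:
  fixes A B :: "(real^2) set" and i j :: 2
  assumes "i \<noteq> j"
    and A: "compact A" "connected A" "\<And>c. connected (A \<inter> {p. p $ i = c})"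
    and B: "compact B" "connected B" "\<And>c. connected (B \<inter> {p. p $ i = c})"
    and "A \<inter> B = {}"
  shows "\<exists>t\<in>{1, -1}. \<forall>a\<in>A. \<forall>b\<in>B. a $ i = b $ i \<longrightarrow> t * b $ j < t * a $ j"
proof -
  have eqI: "p = q" if "p $ i = q $ i" "p $ j = q $ j" for p q :: "real^2"
    using that assms(1) exhaust_2[of i] exhaust_2[of j] by (auto simp: vec_eq_iff forall_2)
  define I where "I = (\<lambda>p. p $ i) ` A \<inter> (\<lambda>p. p $ i) ` B"
  define P where "P t = (\<lambda>(a, b). a $ i) ` {(a, b) \<in> A \<times> B. a $ i = b $ i \<and> t * (b $ j - a $ j) \<le> 0}"
    for t :: real
  have "connected ((\<lambda>p. p $ i) ` A)" "connected ((\<lambda>p. p $ i) ` B)"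
    by (intro connected_continuous_image continuous_intros A B)+
  then have "is_interval I"
    unfolding I_def by (intro is_interval_Int) (simp_all add: is_interval_connected_1)
  then have "connected I"
    by (simp add: is_interval_connected_1)
  have closed: "closed (P t)" for t
  proof -
    have "closed {z :: (real^2) \<times> (real^2). fst z $ i = snd z $ i \<and> t * (snd z $ j - fst z $ j) \<le> 0}"
      by (intro closed_Collect_conj closed_Collect_eq closed_Collect_le continuous_intros)
    then have "compact (A \<times> B \<inter> {z. fst z $ i = snd z $ i \<and> t * (snd z $ j - fst z $ j) \<le> 0})"
      using A B by (intro compact_Int_closed compact_Times) auto
    then have "compact ((\<lambda>z. fst z $ i) ` (A \<times> B \<inter> {z. fst z $ i = snd z $ i \<and> t * (snd z $ j - fst z $ j) \<le> 0}))"
      by (intro compact_continuous_image continuous_intros)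
    also have "(\<lambda>z. fst z $ i) ` (A \<times> B \<inter> {z. fst z $ i = snd z $ i \<and> t * (snd z $ j - fst z $ j) \<le> 0}) = P t"
      unfolding P_def by (rule image_cong) auto
    finally show ?thesis by (rule compact_imp_closed)
  qed
  have disj: "P 1 \<inter> P (-1) \<inter> I = {}"
  proof -
    have False if c: "c \<in> P 1" "c \<in> P (-1)" for c
    proof -
      let ?S = "(A \<inter> {p. p $ i = c}) \<times> (B \<inter> {p. p $ i = c})"
      have "connected ?S"
        using A B by (intro connected_Times) auto
      moreover have "continuous_on ?S (\<lambda>(a, b). b $ j - a $ j)"
        unfolding case_prod_unfold by (intro continuous_intros)
      moreover have "(\<lambda>(a, b). b $ j - a $ j) z \<noteq> 0" if "z \<in> ?S" for z
        using that eqI \<open>A \<inter> B = {}\<close> by (fastforce simp: case_prod_unfold)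
      ultimately obtain s where "s \<in> {1, -1 :: real}"
        and s: "\<forall>z\<in>?S. s * (\<lambda>(a, b). b $ j - a $ j) z < 0"
        using nonvanishing_on_connected_has_sign[of ?S "\<lambda>(a, b). b $ j - a $ j"] by blast
      obtain a b where "(a, b) \<in> ?S" "b $ j - a $ j \<le> 0"
        using c(1) unfolding P_def by auto
      moreover obtain a' b' where "(a', b') \<in> ?S" "b' $ j - a' $ j \<ge> 0"
        using c(2) unfolding P_def by auto
      ultimately have "s * (b $ j - a $ j) < 0" "s * (b' $ j - a' $ j) < 0"
          "b $ j - a $ j \<le> 0" "b' $ j - a' $ j \<ge> 0"
        using bspec[OF s, of "(a, b)"] bspec[OF s, of "(a', b')"] by auto
      then show False
        using \<open>s \<in> {1, -1}\<close> by auto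
    qed
    then show ?thesis by auto
  qed
  have "I \<subseteq> P 1 \<union> P (-1)"
  proof
    fix c assume "c \<in> I"
    then obtain a b where ab: "a \<in> A" "b \<in> B" "a $ i = c" "b $ i = c"
      unfolding I_def by auto
    then have "c \<in> P t" if "t * (b $ j - a $ j) \<le> 0" for t
      using that unfolding P_def by (intro image_eqI[of _ _ "(a, b)"]) auto
    from this[of 1] this[of "-1"] show "c \<in> P 1 \<union> P (-1)"
      by (cases "b $ j \<le> a $ j") auto
  qed
  then consider "P 1 \<inter> I = {}" | "P (-1) \<inter> I = {}"
    using connected_closedD[OF \<open>connected I\<close> disj] closed by blast
  moreover have "\<forall>a\<in>A. \<forall>b\<in>B. a $ i = b $ i \<longrightarrow> - t * b $ j < - t * a $ j" if "P t \<inter> I = {}" for t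
  proof (intro ballI impI, rule ccontr)
    fix a b assume ab: "a \<in> A" "b \<in> B" "a $ i = b $ i" "\<not> - t * b $ j < - t * a $ j"
    then have "a $ i \<in> P t"
      unfolding P_def by (intro image_eqI[of _ _ "(a, b)"]) (auto simp: right_diff_distrib)
    moreover have "a $ i \<in> I"
      unfolding I_def using ab(1-3) by (metis IntI image_eqI)
    ultimately show False using that by auto
  qed
  ultimately show ?thesis
    by (metis insert_iff minus_minus)
qed

text \<open>
  The hypothesis on \<open>q\<close> says that \<open>S\<close> misses the boundary of the closed \<open>(s, t)\<close>-quadrant at \<open>p\<close>. The
  interior and the exterior of that quadrant then disconnect \<open>S\<close> unless it stays in one of them.
\<close>

lemma connected_in_open_quadrant:
  fixes S :: "(real^2) set" and p b q :: "real^2"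
  assumes "connected S" "b \<in> S" "s * p $ 1 < s * b $ 1" "t * p $ 2 < t * b $ 2"
    and "\<And>q. q \<in> S \<Longrightarrow> s * p $ 1 \<le> s * q $ 1 \<Longrightarrow> t * p $ 2 \<le> t * q $ 2
               \<Longrightarrow> s * p $ 1 < s * q $ 1 \<and> t * p $ 2 < t * q $ 2"
    and "q \<in> S"
  shows "s * p $ 1 < s * q $ 1 \<and> t * p $ 2 < t * q $ 2"
proof -
  let ?W = "{q. s * p $ 1 < s * q $ 1 \<and> t * p $ 2 < t * q $ 2}"
  let ?V = "{q. s * q $ 1 < s * p $ 1 \<or> t * q $ 2 < t * p $ 2}"
  have "open ?W" "open ?V"
    by (intro open_Collect_conj open_Collect_disj open_Collect_less continuous_intros)+
  moreover have "?W \<inter> ?V \<inter> S = {}" by auto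
  moreover have "S \<subseteq> ?W \<union> ?V" using assms(5) by force
  ultimately have "?W \<inter> S = {} \<or> ?V \<inter> S = {}"
    using connectedD[OF assms(1)] by blast
  then show ?thesis
    using assms \<open>S \<subseteq> ?W \<union> ?V\<close> by blast
qed

text \<open>
  If the projections to one axis are disjoint, the order of these projections supplies one sign and
  the other is arbitrary. Otherwise the order of the horizontal sections supplies \<open>s\<close>, that of the
  vertical ones supplies \<open>t\<close>, and a common abscissa is what gives the final contradiction.
\<close>

lemma ortho_convex_sets_avoid_a_quadrant:
  fixes A B :: "(real^2) set"
  assumes A: "compact A" "connected A" "ortho_convex A"
    and B: "compact B" "connected B" "ortho_convex B"
    and "A \<inter> B = {}"
  shows "\<exists>s\<in>{1, -1}. \<exists>t\<in>{1, -1}. \<forall>a\<in>A. \<forall>b\<in>B. \<not> (s * a $ 1 \<le> s * b $ 1 \<and> t * a $ 2 \<le> t * b $ 2)"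
proof -
  have projections_apart: "\<exists>s\<in>{1, -1}. \<forall>a\<in>A. \<forall>b\<in>B. s * b $ i < s * a $ i"
    if "\<And>a b. a \<in> A \<Longrightarrow> b \<in> B \<Longrightarrow> a $ i \<noteq> b $ i" for i :: 2
  proof -
    have "continuous_on (A \<times> B) (\<lambda>z. snd z $ i - fst z $ i)"
      by (intro continuous_intros)
    moreover have "snd z $ i - fst z $ i \<noteq> 0" if "z \<in> A \<times> B" for z
      using that \<open>\<And>a b. a \<in> A \<Longrightarrow> b \<in> B \<Longrightarrow> a $ i \<noteq> b $ i\<close>[of "fst z" "snd z"] by auto
    ultimately have "\<exists>s\<in>{1, -1}. \<forall>z\<in>A \<times> B. s * (snd z $ i - fst z $ i) < 0"
      by (rule nonvanishing_on_connected_has_sign[OF connected_Times[OF A(2) B(2)]])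
    then obtain s :: real where "s \<in> {1, -1}"
      and s: "\<forall>z\<in>A \<times> B. s * (snd z $ i - fst z $ i) < 0" by blast
    have "s * b $ i < s * a $ i" if "a \<in> A" "b \<in> B" for a b
      using that bspec[OF s, of "(a, b)"] by (simp add: right_diff_distrib)
    then show ?thesis using \<open>s \<in> {1, -1}\<close> by blast
  qed
  consider (x) "\<And>a b. a \<in> A \<Longrightarrow> b \<in> B \<Longrightarrow> a $ 1 \<noteq> b $ 1"
    | (y) "\<And>a b. a \<in> A \<Longrightarrow> b \<in> B \<Longrightarrow> a $ 2 \<noteq> b $ 2"
    | (meet) a b where "a \<in> A" "b \<in> B" "a $ 1 = b $ 1"
    by blast
  then show ?thesis
  proof cases
    case x
    then obtain u :: real where u: "u \<in> {1, -1}" "\<forall>a\<in>A. \<forall>b\<in>B. u * b $ 1 < u * a $ 1"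
      using projections_apart[of 1] by blast
    then have "\<forall>a\<in>A. \<forall>b\<in>B. \<not> (u * a $ 1 \<le> u * b $ 1 \<and> 1 * a $ 2 \<le> 1 * b $ 2)"
      by (auto simp: not_le)
    then show ?thesis using u(1) by blast
  next
    case y
    then obtain u :: real where u: "u \<in> {1, -1}" "\<forall>a\<in>A. \<forall>b\<in>B. u * b $ 2 < u * a $ 2"
      using projections_apart[of 2] by blast
    then have "\<forall>a\<in>A. \<forall>b\<in>B. \<not> (1 * a $ 1 \<le> 1 * b $ 1 \<and> u * a $ 2 \<le> u * b $ 2)"
      by (auto simp: not_le)
    then show ?thesis using u(1) by blast
  next
    case (meet a\<^sub>0 b\<^sub>0)
    have "\<exists>s\<in>{1, -1}. \<forall>a\<in>A. \<forall>b\<in>B. a $ 2 = b $ 2 \<longrightarrow> s * b $ 1 < s * a $ 1"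
      by (rule disjoint_sections_ordered_alike) (use assms in \<open>auto simp: ortho_convex_def\<close>)
    then obtain s :: real where s: "s \<in> {1, -1}"
      "\<And>a b. a \<in> A \<Longrightarrow> b \<in> B \<Longrightarrow> a $ 2 = b $ 2 \<Longrightarrow> s * b $ 1 < s * a $ 1"
      by blast
    have "\<exists>t\<in>{1, -1}. \<forall>a\<in>A. \<forall>b\<in>B. a $ 1 = b $ 1 \<longrightarrow> t * b $ 2 < t * a $ 2"
      by (rule disjoint_sections_ordered_alike) (use assms in \<open>auto simp: ortho_convex_def\<close>)
    then obtain t :: real where t: "t \<in> {1, -1}"
      "\<And>a b. a \<in> A \<Longrightarrow> b \<in> B \<Longrightarrow> a $ 1 = b $ 1 \<Longrightarrow> t * b $ 2 < t * a $ 2"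
      by blast
    \<comment> \<open>A point of \<open>B\<close> on a side of the quadrant of \<open>a\<close> shares a coordinate with \<open>a\<close>, and would
      be on the wrong side of it in the common section.\<close>
    have strict: "s * a $ 1 < s * b $ 1 \<and> t * a $ 2 < t * b $ 2"
      if "a \<in> A" "b \<in> B" "s * a $ 1 \<le> s * b $ 1" "t * a $ 2 \<le> t * b $ 2" for a b
      using that s t(1) t(2)[of a b] s(2)[of a b] by force
    have False if ab: "a \<in> A" "b \<in> B" "s * a $ 1 \<le> s * b $ 1" "t * a $ 2 \<le> t * b $ 2" for a b
    proof -
      have b0: "s * a $ 1 < s * b\<^sub>0 $ 1 \<and> t * a $ 2 < t * b\<^sub>0 $ 2"
        by (rule connected_in_open_quadrant[OF B(2) ab(2)]) (use strict ab meet in auto)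
      \<comment> \<open>With the signs reversed, the roles of the two sets are interchanged.\<close>
      have "(-s) * b\<^sub>0 $ 1 < (-s) * a\<^sub>0 $ 1 \<and> (-t) * b\<^sub>0 $ 2 < (-t) * a\<^sub>0 $ 2"
        by (rule connected_in_open_quadrant[OF A(2) ab(1)]) (use strict ab meet b0 in auto)
      then show False using meet by simp
    qed
    then show ?thesis using s(1) t(1) by blast
  qed
qed

section \<open>Descending staircases\<close>

text \<open>
  A linear functional that increases from vertex to vertex also increases along every edge, so each
  new edge can meet the part already traversed only in its starting point.
\<close>

lemma arc_polyline_if_increasing:
  fixes v :: "nat \<Rightarrow> 'a::real_normed_vector" and f :: "'a \<Rightarrow> real"
  assumes "linear f" and incr: "\<And>i. f (v i) < f (v (Suc i))"
  shows "arc (polyline v (Suc n))"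
proof -
  have f_line: "f (linepath a b u) = f a + u * (f b - f a)" for a b u
    unfolding linepath_def linear_add[OF assms(1)] linear_cmul[OF assms(1)]
    by (simp add: algebra_simps)
  have edge: "f a < f p" if ab: "f a < f b" and p: "p \<in> path_image (linepath a b)" "p \<noteq> a" for a b p
  proof -
    obtain u where u: "0 \<le> u" "p = linepath a b u"
      using p unfolding path_image_def by auto
    with p(2) have "u > 0" by (cases "u = 0") (auto simp: linepath_0')
    then show ?thesis using ab u f_line by simp
  qed
  have below: "f p \<le> f b" if ab: "f a < f b" and p: "p \<in> path_image (linepath a b)" for a b p
  proof -
    obtain u where u: "u \<le> 1" "p = linepath a b u"
      using p unfolding path_image_def by auto
    have "u * (f b - f a) \<le> 1 * (f b - f a)"
      using ab u by (intro mult_right_mono) auto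
    then show ?thesis using u f_line by simp
  qed
  have "arc (polyline v (Suc n)) \<and> pathfinish (polyline v (Suc n)) = v (Suc n)
      \<and> (\<forall>p\<in>path_image (polyline v (Suc n)). f p \<le> f (v (Suc n)))"
  proof (induction n)
    case 0
    have "v 0 \<noteq> v 1" using incr[of 0] by auto
    then show ?case using below[of "v 0" "v 1"] incr[of 0] by (auto simp del: path_image_linepath intro: arc_linepath)
  next
    case (Suc n)
    let ?e = "linepath (v (Suc n)) (v (Suc (Suc n)))"
    have ne: "v (Suc n) \<noteq> v (Suc (Suc n))" using incr[of "Suc n"] by auto
    have "arc (polyline v (Suc n) +++ ?e)"
    proof (rule arc_join)
      show "path_image (polyline v (Suc n)) \<inter> path_image ?e \<subseteq> {pathstart ?e}"
        using Suc edge[OF incr[of "Suc n"]] by force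
    qed (use Suc ne arc_linepath in auto)
    moreover have "\<forall>p\<in>path_image (polyline v (Suc n) +++ ?e). f p \<le> f (v (Suc (Suc n)))"
      using Suc below[OF incr[of "Suc n"]] incr[of "Suc n"]
      by (subst path_image_join) (auto simp del: path_image_linepath intro: order_trans less_imp_le)
    ultimately show ?case by simp
  qed
  then show ?thesis by blast
qed

text \<open>
  The corners of a descending staircase with treads at the heights \<open>y 0, y 1, \<dots>\<close>: edges from an even to
  an odd index are treads, leading from \<open>x k\<close> to \<open>x (Suc k)\<close> at height \<open>y k\<close>, and edges from an odd to
  an even index are the drops at \<open>x (Suc k)\<close>.
\<close>

definition corner :: "(nat \<Rightarrow> real) \<Rightarrow> (nat \<Rightarrow> real) \<Rightarrow> nat \<Rightarrow> real^2" where
  "corner x y i = vector [x ((i + 1) div 2), y (i div 2)]"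

lemma corner_even: "corner x y (2 * k) = vector [x k, y k]"
  and corner_odd: "corner x y (Suc (2 * k)) = vector [x (Suc k), y k]"
  by (simp_all add: corner_def)

lemma staircase_segment_corner:
  assumes x: "\<And>k. x k < x (Suc k)" and y: "\<And>k. y (Suc k) < y k"
  shows "staircase_segment (corner x y) (Suc n)"
proof -
  have "\<exists>k. i = 2 * k \<or> i = Suc (2 * k)" for i :: nat
    by presburger
  then have parity: thesis
    if "\<And>k. i = 2 * k \<Longrightarrow> thesis" "\<And>k. i = Suc (2 * k) \<Longrightarrow> thesis" for i :: nat and thesis
    using that by blast
  have odd_step: "corner x y (Suc (2 * k)) - corner x y (2 * k) = (x (Suc k) - x k) *\<^sub>R vector [1, 0]" for k
    unfolding corner_even corner_odd by (simp add: vec_eq_iff forall_2)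
  have even_step: "corner x y (2 * Suc k) - corner x y (Suc (2 * k)) = (y k - y (Suc k)) *\<^sub>R vector [0, -1]" for k
    unfolding corner_even corner_odd by (simp add: vec_eq_iff forall_2)
  have dir1: "sgn (corner x y i - corner x y (i - 1)) = sgn (vector [1, 0])" if "odd i" for i
  proof -
    from that obtain k where "i = Suc (2 * k)" by (auto elim: oddE)
    then show ?thesis using odd_step[of k] x[of k] by (simp add: sgn_scaleR)
  qed
  have dir2: "sgn (corner x y i - corner x y (i - 1)) = sgn (vector [0, -1])" if "even i" "1 \<le> i" for i
  proof -
    from that obtain k where "i = 2 * Suc k" by (metis evenE mult_0_right not0_implies_Suc not_one_le_zero)
    then show ?thesis using even_step[of k] y[of k] by (simp add: sgn_scaleR)
  qed
  have aligned: "axis_aligned (corner x y i) (corner x y (Suc i))" for i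
  proof (rule parity[of i])
    fix k assume "i = 2 * k"
    then show ?thesis unfolding axis_aligned_def
      using x[of k] by (simp add: corner_even corner_odd vec_eq_iff forall_2)
  next
    fix k assume "i = Suc (2 * k)"
    moreover have "corner x y (Suc (Suc (2 * k))) = vector [x (Suc k), y (Suc k)]"
      using corner_even[of x y "Suc k"] by simp
    ultimately show ?thesis unfolding axis_aligned_def
      using y[of k] by (simp add: corner_odd vec_eq_iff forall_2)
  qed
  have "arc (polyline (corner x y) (Suc n))"
  proof (rule arc_polyline_if_increasing)
    \<comment> \<open>Along a step to the right or down, the difference of the coordinates increases.\<close>
    show "linear (\<lambda>p :: real^2. p $ 1 - p $ 2)"
      by (intro linearI) (auto simp: algebra_simps)
    show "corner x y i $ 1 - corner x y i $ 2 < corner x y (Suc i) $ 1 - corner x y (Suc i) $ 2" for i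
    proof (rule parity[of i])
      fix k assume "i = 2 * k"
      then show ?thesis using x[of k] by (simp add: corner_even corner_odd)
    next
      fix k assume "i = Suc (2 * k)"
      moreover have "corner x y (Suc (Suc (2 * k))) = vector [x (Suc k), y (Suc k)]"
        using corner_even[of x y "Suc k"] by simp
      ultimately show ?thesis using y[of k] by (simp add: corner_odd)
    qed
  qed
  moreover have "axis_aligned (corner x y (i - 1)) (corner x y i)" if "i \<in> {1..Suc n}" for i
    using aligned[of "i - 1"] that by simp
  ultimately show ?thesis
    unfolding staircase_segment_def using dir1 dir2 by auto
qed

lemma horizontal_segment:
  assumes "a \<le> b"
  shows "closed_segment (vector [a, c]) (vector [b, c] :: real^2) = {p. a \<le> p $ 1 \<and> p $ 1 \<le> b \<and> p $ 2 = c}"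
proof -
  have "p \<in> closed_segment (vector [a, c]) (vector [b, c]) \<longleftrightarrow> p $ 1 \<in> closed_segment a b \<and> p $ 2 = c"
    for p :: "real^2"
    unfolding closed_segment_def by (auto simp: vec_eq_iff forall_2 algebra_simps)
  then show ?thesis using assms by (auto simp: closed_segment_eq_real_ivl set_eq_iff split: if_splits)
qed

lemma vertical_segment:
  assumes "a \<le> b"
  shows "closed_segment (vector [c, b]) (vector [c, a] :: real^2) = {p. p $ 1 = c \<and> a \<le> p $ 2 \<and> p $ 2 \<le> b}"
proof -
  have "p \<in> closed_segment (vector [c, b]) (vector [c, a]) \<longleftrightarrow> p $ 1 = c \<and> p $ 2 \<in> closed_segment b a"
    for p :: "real^2"
    unfolding closed_segment_def by (auto simp: vec_eq_iff forall_2 algebra_simps)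
  then show ?thesis using assms by (auto simp: closed_segment_eq_real_ivl set_eq_iff split: if_splits)
qed

lemma leftward_ray:
  assumes "a < b"
  shows "ray (vector [b, c]) (vector [a, c] :: real^2) = {p. p $ 1 \<le> b \<and> p $ 2 = c}"
proof -
  have "p \<in> ray (vector [b, c]) (vector [a, c])" if "p $ 1 \<le> b" "p $ 2 = c" for p :: "real^2"
    unfolding ray_def using that assms
    by (auto simp: vec_eq_iff forall_2 field_simps intro!: exI[of _ "(b - p $ 1) / (b - a)"])
  moreover have "t * (a - b) \<le> 0" if "0 \<le> t" for t
    using that assms by (simp add: mult_nonneg_nonpos)
  ultimately show ?thesis unfolding ray_def by auto
qed

lemma rightward_ray:
  assumes "a < b"
  shows "ray (vector [a, c]) (vector [b, c] :: real^2) = {p. a \<le> p $ 1 \<and> p $ 2 = c}"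
proof -
  have "p \<in> ray (vector [a, c]) (vector [b, c])" if "a \<le> p $ 1" "p $ 2 = c" for p :: "real^2"
    unfolding ray_def using that assms
    by (auto simp: vec_eq_iff forall_2 field_simps intro!: exI[of _ "(p $ 1 - a) / (b - a)"])
  then show ?thesis unfolding ray_def using assms by auto
qed

text \<open>
  The treads \<open>0, \<dots>, m\<close> and the drops between them. The exceptions for \<open>k = 0\<close> and \<open>k = m\<close> prolong the
  first and the last tread to horizontal rays.
\<close>

definition staircase_of :: "(nat \<Rightarrow> real) \<Rightarrow> (nat \<Rightarrow> real) \<Rightarrow> nat \<Rightarrow> (real^2) set" where
  "staircase_of x y m =
     (\<Union>k\<le>m. {p. (k = 0 \<or> x k \<le> p $ 1) \<and> (k = m \<or> p $ 1 \<le> x (Suc k)) \<and> p $ 2 = y k})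
     \<union> (\<Union>k<m. {p. p $ 1 = x (Suc k) \<and> y (Suc k) \<le> p $ 2 \<and> p $ 2 \<le> y k})"

text \<open>
  The staircase runs through the corners \<open>0, \<dots>, 2 * m + 1\<close>. For \<open>m = 0\<close> it is a horizontal line,
  covered by two overlapping rays.
\<close>

lemma staircase_line_staircase_of:
  assumes x: "\<And>k. x k < x (Suc k)" and y: "\<And>k. y (Suc k) < y k"
  shows "staircase_line (staircase_of x y m)"
proof -
  let ?v = "corner x y"
  let ?S = "\<Union>i\<in>{1<..<Suc (2 * m)}. closed_segment (?v (i - 1)) (?v i)"
  have first: "ray (?v 1) (?v 0) = {p. p $ 1 \<le> x 1 \<and> p $ 2 = y 0}"
    using leftward_ray[OF x[of 0]] corner_even[of x y 0] corner_odd[of x y 0] by simp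
  have last: "ray (?v (2 * m)) (?v (Suc (2 * m))) = {p. x m \<le> p $ 1 \<and> p $ 2 = y m}"
    unfolding corner_even corner_odd by (rule rightward_ray[OF x])
  have hor: "closed_segment (?v (2 * k)) (?v (Suc (2 * k))) = {p. x k \<le> p $ 1 \<and> p $ 1 \<le> x (Suc k) \<and> p $ 2 = y k}" for k
    unfolding corner_even corner_odd by (rule horizontal_segment) (use x[of k] in simp)
  have ver: "closed_segment (?v (Suc (2 * k))) (?v (Suc (Suc (2 * k)))) = {p. p $ 1 = x (Suc k) \<and> y (Suc k) \<le> p $ 2 \<and> p $ 2 \<le> y k}" for k
    using vertical_segment[of "y (Suc k)" "y k" "x (Suc k)"] y[of k]
      corner_even[of x y "Suc k"] corner_odd[of x y k] by simp
  have edges: "?S = (\<Union>k\<in>{0<..<m}. closed_segment (?v (2 * k)) (?v (Suc (2 * k))))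
      \<union> (\<Union>k<m. closed_segment (?v (Suc (2 * k))) (?v (Suc (Suc (2 * k)))))" (is "_ = ?H \<union> ?V")
  proof (intro equalityI subsetI)
    fix p assume "p \<in> ?S"
    then obtain i where i: "1 < i" "i < Suc (2 * m)" "p \<in> closed_segment (?v (i - 1)) (?v i)"
      by auto
    show "p \<in> ?H \<union> ?V"
    proof (cases "even i")
      case True
      then obtain k where k: "i = Suc (Suc (2 * k))" using i(1)
        by (metis add_2_eq_Suc dvd_def mult_Suc_right mult_is_0 not0_implies_Suc not_one_less_zero)
      then show ?thesis using i by auto
    next
      case False
      then obtain k where k: "i = Suc (2 * k)" by (auto elim: oddE)
      then show ?thesis using i by auto
    qed
  next
    fix p assume "p \<in> ?H \<union> ?V"
    then consider k where "0 < k" "k < m" "p \<in> closed_segment (?v (2 * k)) (?v (Suc (2 * k)))"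
      | k where "k < m" "p \<in> closed_segment (?v (Suc (2 * k))) (?v (Suc (Suc (2 * k))))"
      by auto
    then show "p \<in> ?S"
    proof cases
      case 1
      then show ?thesis by (intro UN_I[of "Suc (2 * k)"]) auto
    next
      case 2
      then show ?thesis by (intro UN_I[of "Suc (Suc (2 * k))"]) auto
    qed
  qed
  have "staircase_of x y m = ray (?v 1) (?v 0) \<union> ?S \<union> ray (?v (2 * m)) (?v (Suc (2 * m)))"
    (is "_ = ?R")
  proof (rule set_eqI)
    fix p :: "real^2"
    have "(\<exists>k\<le>m. (k = 0 \<or> x k \<le> p $ 1) \<and> (k = m \<or> p $ 1 \<le> x (Suc k)) \<and> p $ 2 = y k) \<longleftrightarrow>
        (p $ 1 \<le> x 1 \<and> p $ 2 = y 0) \<or> (x m \<le> p $ 1 \<and> p $ 2 = y m) \<or>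
        (\<exists>k. 0 < k \<and> k < m \<and> x k \<le> p $ 1 \<and> p $ 1 \<le> x (Suc k) \<and> p $ 2 = y k)"
      (is "?lhs \<longleftrightarrow> ?rhs")
    proof
      assume ?lhs
      then obtain k where k: "k \<le> m" "k = 0 \<or> x k \<le> p $ 1" "k = m \<or> p $ 1 \<le> x (Suc k)" "p $ 2 = y k"
        by blast
      show ?rhs
      proof (cases "k = 0 \<or> k = m")
        case True
        then show ?thesis using k x[of 0] by (cases "m = 0") auto
      next
        case False
        then have "0 < k" "k < m" using k(1) by auto
        then show ?thesis using k by blast
      qed
    next
      assume ?rhs
      then show ?lhs by (metis One_nat_def le0 less_imp_le order_refl)
    qed
    then show "p \<in> staircase_of x y m \<longleftrightarrow> p \<in> ?R"
      unfolding staircase_of_def first last edges hor ver by auto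
  qed
  then show ?thesis
    unfolding staircase_line_def using staircase_segment_corner[of x y "2 * m"] x y
    by (intro exI[of _ ?v] exI[of _ "Suc (2 * m)"]) auto
qed

text \<open>
  The closed region on and below the staircase is the union of the quadrants to the lower left of
  the points \<open>(x (Suc k), y k)\<close>, where \<open>k = m\<close> stands for a halfplane because the last tread does not
  end. The two open sides are the complement and the interior of this region.
\<close>

definition above_staircase :: "(nat \<Rightarrow> real) \<Rightarrow> (nat \<Rightarrow> real) \<Rightarrow> nat \<Rightarrow> (real^2) set" where
  "above_staircase x y m = (\<Inter>k\<le>m. {p. k \<noteq> m \<and> x (Suc k) < p $ 1 \<or> y k < p $ 2})"

definition below_staircase :: "(nat \<Rightarrow> real) \<Rightarrow> (nat \<Rightarrow> real) \<Rightarrow> nat \<Rightarrow> (real^2) set" where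
  "below_staircase x y m = (\<Union>k\<le>m. {p. (k = m \<or> p $ 1 < x (Suc k)) \<and> p $ 2 < y k})"

lemma above_staircase_iff:
  "p \<in> above_staircase x y m \<longleftrightarrow> (\<forall>k\<le>m. k \<noteq> m \<and> x (Suc k) < p $ 1 \<or> y k < p $ 2)"
  by (auto simp: above_staircase_def)

lemma below_staircase_iff:
  "p \<in> below_staircase x y m \<longleftrightarrow> (\<exists>k\<le>m. (k = m \<or> p $ 1 < x (Suc k)) \<and> p $ 2 < y k)"
  by (auto simp: below_staircase_def)

lemma open_above_staircase: "open (above_staircase x y m)"
proof -
  have "open {p :: real^2. k \<noteq> m \<and> x (Suc k) < p $ 1 \<or> y k < p $ 2}" for k
    by (cases "k = m") (simp_all add: open_Collect_disj open_Collect_less continuous_on_component)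
  then show ?thesis unfolding above_staircase_def by (intro open_INT) auto
qed

lemma open_below_staircase: "open (below_staircase x y m)"
proof -
  have "open {p :: real^2. (k = m \<or> p $ 1 < x (Suc k)) \<and> p $ 2 < y k}" for k
    by (cases "k = m") (simp_all add: open_Collect_conj open_Collect_less continuous_on_component)
  then show ?thesis unfolding below_staircase_def by (intro open_UN) auto
qed

lemma above_below_disjoint: "above_staircase x y m \<inter> below_staircase x y m = {}"
  unfolding disjoint_iff above_staircase_iff below_staircase_iff
  by (blast dest: less_asym)

text \<open>
  For a point on neither side, the first \<open>k\<close> whose closed quadrant contains it identifies the edge it
  lies on: tread \<open>k\<close> if the point has height \<open>y k\<close>, and otherwise the drop at \<open>x (Suc k)\<close>.
\<close>

lemma Compl_staircase_of:
  assumes x: "strict_mono x" and y: "\<And>i j. i < j \<Longrightarrow> y j < y i"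
  shows "- staircase_of x y m = above_staircase x y m \<union> below_staircase x y m"
proof (intro equalityI subsetI)
  fix p assume "p \<in> - staircase_of x y m"
  then have notin: "p \<notin> staircase_of x y m" by simp
  show "p \<in> above_staircase x y m \<union> below_staircase x y m"
  proof (rule ccontr)
    assume neg: "p \<notin> above_staircase x y m \<union> below_staircase x y m"
    define Q where "Q k \<longleftrightarrow> k \<le> m \<and> (k = m \<or> p $ 1 \<le> x (Suc k)) \<and> p $ 2 \<le> y k" for k
    define k where "k = (LEAST k. Q k)"
    have "\<exists>k. Q k"
      using neg unfolding Un_iff above_staircase_iff Q_def by (auto simp: not_less)
    then have k: "Q k" unfolding k_def by (rule LeastI_ex)
    have least: "\<not> Q j" if "j < k" for j
      using that unfolding k_def by (rule not_less_Least)
    have nb: "\<not> ((j = m \<or> p $ 1 < x (Suc j)) \<and> p $ 2 < y j)" if "j \<le> m" for j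
      using neg that unfolding Un_iff below_staircase_iff by blast
    show False
    proof (cases "p $ 2 = y k")
      case True
      have "k = 0 \<or> x k \<le> p $ 1"
      proof (rule ccontr)
        assume "\<not> ?thesis"
        then obtain j where j: "k = Suc j" "p $ 1 < x k" by (metis not0_implies_Suc not_le)
        have "Q j" using j k True y[of j k] unfolding Q_def by simp
        then show False using least j by simp
      qed
      then show False
        using notin k True unfolding staircase_of_def Q_def by auto
    next
      case False
      then have "p $ 2 < y k" "k \<le> m" using k unfolding Q_def by auto
      then have km: "k < m" "p $ 1 = x (Suc k)"
        using nb[of k] k unfolding Q_def by (auto simp: order_less_le)
      have "y (Suc k) \<le> p $ 2"
        using nb[of "Suc k"] km strict_monoD[OF x, of "Suc k" "Suc (Suc k)"] by force
      then show False
        using notin km \<open>p $ 2 < y k\<close> unfolding staircase_of_def by auto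
    qed
  qed
next
  have x': "x i \<le> x j" if "i \<le> j" for i j
    using that x by (simp add: strict_mono_less_eq)
  have y': "y j \<le> y i" if "i \<le> j" for i j
    using that y[of i j] by (cases "i = j") auto
  fix p assume p: "p \<in> above_staircase x y m \<union> below_staircase x y m"
  show "p \<in> - staircase_of x y m"
  proof
    assume "p \<in> staircase_of x y m"
    then consider (hor) k where "k \<le> m" "k = 0 \<or> x k \<le> p $ 1" "k = m \<or> p $ 1 \<le> x (Suc k)" "p $ 2 = y k"
      | (ver) k where "k < m" "p $ 1 = x (Suc k)" "y (Suc k) \<le> p $ 2" "p $ 2 \<le> y k"
      unfolding staircase_of_def by blast
    then show False
    proof cases
      case hor
      then have "\<not> (k \<noteq> m \<and> x (Suc k) < p $ 1 \<or> y k < p $ 2)" "k \<le> m" by auto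
      then have "p \<notin> above_staircase x y m"
        unfolding above_staircase_iff by blast
      then obtain j where j: "j \<le> m" "j = m \<or> p $ 1 < x (Suc j)" "p $ 2 < y j"
        using p unfolding Un_iff below_staircase_iff by blast
      then have "j < k" using hor y'[of k j] by force
      then show False using hor j x'[of "Suc j" k] by auto
    next
      case ver
      then have "\<not> (k \<noteq> m \<and> x (Suc k) < p $ 1 \<or> y k < p $ 2)" "k \<le> m" by auto
      then have "p \<notin> above_staircase x y m"
        unfolding above_staircase_iff by blast
      then obtain j where j: "j \<le> m" "j = m \<or> p $ 1 < x (Suc j)" "p $ 2 < y j"
        using p unfolding Un_iff below_staircase_iff by blast
      have "Suc k \<le> j" using j ver x'[of "Suc j" "Suc k"] by force
      then show False using j ver y'[of "Suc k" j] by auto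
    qed
  qed
qed

section \<open>Separation along a staircase\<close>

text \<open>
  The sides are only asked to be open and disjoint: this tells components on different sides apart
  and carries over to mirror images.
\<close>

definition splits :: "(real^2) set \<Rightarrow> (real^2) set \<Rightarrow> (real^2) set \<Rightarrow> bool" where
  "splits l U L \<longleftrightarrow> open U \<and> open L \<and> U \<noteq> {} \<and> L \<noteq> {} \<and> U \<inter> L = {} \<and> - l = U \<union> L"

text \<open>
  A component of the complement that meets one side stays in it, and its closure misses the other
  side because that side is open. Hence components on different sides have different closures. An
  empty set is accommodated by any component on its side.
\<close>

lemma strictly_separates_splits:
  assumes "splits l U L" "connected A" "A \<subseteq> U" "connected B" "B \<subseteq> L"
  shows "strictly_separates l A B"
proof -
  have split: "open U" "open L" "U \<noteq> {}" "L \<noteq> {}" "U \<inter> L = {}" "- l = U \<union> L"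
    using assms(1) unfolding splits_def by auto
  have comp: "\<exists>C\<in>components (- l). S \<subseteq> C \<and> C \<subseteq> V"
    if S: "connected S" "S \<subseteq> V" and VW: "open V" "open W" "V \<noteq> {}" "V \<inter> W = {}" "- l = V \<union> W" for S V W
  proof -
    obtain S' where S': "connected S'" "S \<subseteq> S'" "S' \<noteq> {}" "S' \<subseteq> V"
    proof (cases "S = {}")
      case True
      obtain q where "q \<in> V" using \<open>V \<noteq> {}\<close> by blast
      then show ?thesis using that[of "{q}"] True by auto
    qed (use S in blast)
    have "- l \<noteq> {}" using \<open>- l = V \<union> W\<close> \<open>V \<noteq> {}\<close> by auto
    then obtain C where C: "C \<in> components (- l)" "S' \<subseteq> C"
      using exists_component_superset[of S' "- l"] S' \<open>- l = V \<union> W\<close> by blast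
    have "C \<subseteq> V \<union> W" using in_components_subset[OF C(1)] \<open>- l = V \<union> W\<close> by simp
    then have "V \<inter> C = {} \<or> W \<inter> C = {}"
      using connectedD[OF in_components_connected[OF C(1)] \<open>open V\<close> \<open>open W\<close>] \<open>V \<inter> W = {}\<close> by blast
    then have "C \<subseteq> V" using \<open>C \<subseteq> V \<union> W\<close> C S' by blast
    then show ?thesis using C S' by blast
  qed
  obtain C where C: "C \<in> components (- l)" "A \<subseteq> C" "C \<subseteq> U"
    using comp[of A U L] assms split by blast
  obtain D where D: "D \<in> components (- l)" "B \<subseteq> D" "D \<subseteq> L"
    using comp[of B L U] assms split by blast
  have "closure C \<noteq> closure D"
  proof -
    have "closure C \<subseteq> - L"
      using C split by (intro closure_minimal) (auto simp: closed_Compl)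
    moreover have "D \<subseteq> closure D" "D \<noteq> {}"
      using closure_subset in_components_nonempty[OF D(1)] by auto
    ultimately show ?thesis using D by blast
  qed
  moreover have "A \<subseteq> closure C" "B \<subseteq> closure D"
    using C D closure_subset by blast+
  ultimately have "separates l A B"
    unfolding separates_def staircase_halfplanes_def using C D by blast
  moreover have "A \<inter> l = {}" "B \<inter> l = {}"
    using assms split by blast+
  ultimately show ?thesis unfolding strictly_separates_def by blast
qed

text \<open>
  The hypothesis says that \<open>max (a $ 1 - b $ 1) (a $ 2 - b $ 2)\<close> is positive on \<open>A \<times> B\<close>. By
  compactness it has a positive lower bound, half of which is a margin that can be given away in
  the first coordinate while keeping as much in the second.
\<close>

lemma uniform_gap:
  fixes A B :: "(real^2) set"
  assumes "compact A" "compact B"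
    and "\<And>a b. a \<in> A \<Longrightarrow> b \<in> B \<Longrightarrow> \<not> (a $ 1 \<le> b $ 1 \<and> a $ 2 \<le> b $ 2)"
  obtains e :: real where "0 < e"
    and "\<And>a b. a \<in> A \<Longrightarrow> b \<in> B \<Longrightarrow> a $ 1 - b $ 1 \<le> e \<Longrightarrow> e < a $ 2 - b $ 2"
proof (cases "A \<times> B = {}")
  case True
  then show ?thesis using that[of 1] by auto
next
  case False
  let ?f = "\<lambda>z :: (real^2) \<times> (real^2). max (fst z $ 1 - snd z $ 1) (fst z $ 2 - snd z $ 2)"
  have "continuous_on (A \<times> B) ?f"
    by (intro continuous_intros)
  then obtain z where z: "z \<in> A \<times> B" "\<And>w. w \<in> A \<times> B \<Longrightarrow> ?f z \<le> ?f w"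
    using continuous_attains_inf[OF compact_Times[OF assms(1,2)] False] by blast
  define d where "d = ?f z"
  have "0 < d" unfolding d_def using assms(3)[of "fst z" "snd z"] z(1) by (auto simp: less_max_iff_disj mem_Times_iff)
  moreover have "d / 2 < a $ 2 - b $ 2" if "a \<in> A" "b \<in> B" "a $ 1 - b $ 1 \<le> d / 2" for a b
  proof -
    have "d \<le> max (a $ 1 - b $ 1) (a $ 2 - b $ 2)"
      unfolding d_def using z(2)[of "(a, b)"] that by simp
    then show ?thesis using that(3) \<open>0 < d\<close> unfolding le_max_iff_disj by linarith
  qed
  ultimately show ?thesis using that[of "d / 2"] by simp
qed

text \<open>
  Let \<open>\<beta> c\<close> be the least upper bound of the heights of \<open>B\<close> on or to the right of \<open>c\<close>. Tread \<open>k\<close> is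
  placed above \<open>\<beta> (x k)\<close> by less than \<open>e\<close>. A point of \<open>A\<close> to the left of \<open>x (Suc k)\<close> is at most \<open>e\<close>
  further right than any point of \<open>B\<close> beyond \<open>x k\<close>, hence more than \<open>e\<close> higher, which puts it above
  the tread.
\<close>

lemma staircase_between:
  fixes A B :: "(real^2) set"
  assumes "compact A" "compact B"
    and apart: "\<And>a b. a \<in> A \<Longrightarrow> b \<in> B \<Longrightarrow> \<not> (a $ 1 \<le> b $ 1 \<and> a $ 2 \<le> b $ 2)"
  shows "\<exists>l U L. staircase_line l \<and> splits l U L \<and> A \<subseteq> U \<and> B \<subseteq> L"
proof -
  obtain e where e: "0 < e"
    and gap: "\<And>a b. a \<in> A \<Longrightarrow> b \<in> B \<Longrightarrow> a $ 1 - b $ 1 \<le> e \<Longrightarrow> e < a $ 2 - b $ 2"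
    using uniform_gap[OF assms] by metis
  have "bounded (A \<union> B)" using assms compact_imp_bounded by auto
  then obtain K where K: "\<And>p. p \<in> A \<union> B \<Longrightarrow> norm p \<le> K" unfolding bounded_iff by blast
  \<comment> \<open>The extra \<open>e\<close> keeps the points of \<open>A\<close> above the treads where \<open>\<beta>\<close> takes its default
    value \<open>-M\<close>.\<close>
  define M where "M = K + e"
  have M: "-M + e \<le> p $ i" "p $ i \<le> M" if "p \<in> A \<union> B" for p i
    using K[OF that] component_le_norm_cart[of p i] e unfolding M_def by linarith+
  define x where "x k = -M + real k * e" for k
  define \<beta> where "\<beta> c = Sup (insert (-M) ((\<lambda>b. b $ 2) ` {b\<in>B. c \<le> b $ 1}))" for c
  \<comment> \<open>The second summand stays in the open interval from \<open>0\<close> to \<open>e\<close>, and its decrease makes every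
    drop nondegenerate where \<open>\<beta>\<close> is constant.\<close>
  define y where "y k = \<beta> (x k) + e / (real k + 2)" for k
  obtain m :: nat where "2 * M / e < real m" using reals_Archimedean2 by blast
  then have "2 * M < real m * e" using e by (simp add: field_simps)
  then have xm: "M \<le> x (Suc m)" unfolding x_def using e by (simp add: algebra_simps)
  have x: "strict_mono x" using e by (intro strict_monoI) (simp add: x_def)
  have bdd: "bdd_above (insert (-M) ((\<lambda>b. b $ 2) ` {b\<in>B. c \<le> b $ 1}))" for c
    using M by (auto intro!: bdd_aboveI[of _ M])
  have \<beta>_anti: "\<beta> d \<le> \<beta> c" if "c \<le> d" for c d
    unfolding \<beta>_def by (rule cSup_subset_mono) (use bdd that in auto)
  have y: "y j < y i" if "i < j" for i j
  proof -
    have "x i \<le> x j" using that x by (simp add: strict_mono_less_eq)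
    moreover have "e / (real j + 2) < e / (real i + 2)"
      using that e by (intro divide_strict_left_mono) auto
    ultimately show ?thesis unfolding y_def using \<beta>_anti by (intro add_le_less_mono)
  qed
  have below: "b $ 2 < y k" if "b \<in> B" "x k \<le> b $ 1" for b k
  proof -
    have "b $ 2 \<le> \<beta> (x k)" unfolding \<beta>_def by (rule cSup_upper) (use bdd that in auto)
    then show ?thesis unfolding y_def using e by (simp add: add_le_less_mono order_le_less_trans)
  qed
  have above: "y k < a $ 2" if "a \<in> A" "a $ 1 \<le> x (Suc k)" for a k
  proof -
    have "\<beta> (x k) \<le> a $ 2 - e"
      unfolding \<beta>_def
    proof (rule cSup_least)
      fix z assume "z \<in> insert (-M) ((\<lambda>b. b $ 2) ` {b\<in>B. x k \<le> b $ 1})"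
      then consider "z = -M" | b where "b \<in> B" "x k \<le> b $ 1" "z = b $ 2" by auto
      then show "z \<le> a $ 2 - e"
      proof cases
        case 1
        then show ?thesis using M(1)[of a 2] that by simp
      next
        case 2
        have "a $ 1 - b $ 1 \<le> e" using that 2 by (simp add: x_def algebra_simps)
        then show ?thesis using gap[of a b] that 2 by simp
      qed
    qed simp
    moreover have "e / (real k + 2) < e / 1" using e by (intro divide_strict_left_mono) auto
    ultimately show ?thesis unfolding y_def by simp
  qed
  have "A \<subseteq> above_staircase x y m"
  proof
    fix a assume a: "a \<in> A"
    have "y m < a $ 2" using above[OF a, of m] M(2)[of a 1] xm a by simp
    moreover have "x (Suc k) < a $ 1 \<or> y k < a $ 2" for k using above[OF a, of k] by force
    ultimately show "a \<in> above_staircase x y m" unfolding above_staircase_def by auto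
  qed
  moreover have "B \<subseteq> below_staircase x y m"
  proof
    fix b assume b: "b \<in> B"
    \<comment> \<open>\<open>b\<close> lies below the last tread that starts at or to the left of it.\<close>
    define P where "P k \<longleftrightarrow> k \<le> m \<and> x k \<le> b $ 1" for k
    define k where "k = (GREATEST k. P k)"
    have "P 0" using M(1)[of b 1] b e unfolding P_def x_def by simp
    have bound: "\<And>k. P k \<Longrightarrow> k \<le> m" unfolding P_def by simp
    have "P k" unfolding k_def using GreatestI_nat[of P, OF \<open>P 0\<close>] bound by blast
    moreover have "k = m \<or> b $ 1 < x (Suc k)"
    proof (rule ccontr)
      assume "\<not> ?thesis"
      then have "P (Suc k)" using \<open>P k\<close> unfolding P_def by auto
      then have "Suc k \<le> k" unfolding k_def using Greatest_le_nat[of P] bound by blast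
      then show False by simp
    qed
    ultimately show "b \<in> below_staircase x y m"
      using below[OF b, of k] unfolding below_staircase_def P_def by auto
  qed
  moreover have "splits (staircase_of x y m) (above_staircase x y m) (below_staircase x y m)"
  proof -
    have "vector [0, y 0 + 1] \<in> above_staircase x y m"
    proof -
      have "y k < y 0 + 1" for k using y[of 0 k] by (cases "k = 0") auto
      then show ?thesis unfolding above_staircase_def by simp
    qed
    moreover have "vector [0, y m - 1] \<in> below_staircase x y m"
      unfolding below_staircase_def by (intro UN_I[of m]) auto
    ultimately show ?thesis
      unfolding splits_def using open_above_staircase open_below_staircase above_below_disjoint
        Compl_staircase_of[of x y m] x y by blast
  qed
  moreover have "staircase_line (staircase_of x y m)"
    using x y by (intro staircase_line_staircase_of) (auto simp: strict_mono_Suc_iff)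
  ultimately show ?thesis by blast
qed

section \<open>Reflections\<close>

text \<open>
  For signs \<open>s\<close> and \<open>t\<close> these are the identity, the reflections in the two axes and the point
  reflection: involutive linear isometries that preserve all notions in question and one of
  them carries a given quadrant to the upper right one.
\<close>

definition reflect :: "real \<Rightarrow> real \<Rightarrow> real^2 \<Rightarrow> real^2" where
  "reflect s t p = vector [s * p $ 1, t * p $ 2]"

lemma reflect_component [simp]: "reflect s t p $ 1 = s * p $ 1" "reflect s t p $ 2 = t * p $ 2"
  by (simp_all add: reflect_def)

lemma linear_reflect: "linear (reflect s t)"
  by (intro linearI) (auto simp: vec_eq_iff forall_2 algebra_simps)

lemma reflect_reflect:
  assumes "s \<in> {1, -1}" "t \<in> {1, -1}"
  shows "reflect s t (reflect s t p) = p"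
  using assms by (auto simp: vec_eq_iff forall_2)

lemma norm_reflect:
  assumes "s \<in> {1, -1}" "t \<in> {1, -1}"
  shows "norm (reflect s t p) = norm p"
  using assms by (auto simp: norm_vec_def L2_set_def sum_2)

lemma polyline_linear_image:
  fixes f :: "'a::real_normed_vector \<Rightarrow> 'b::real_normed_vector"
  assumes "linear f"
  shows "polyline (f \<circ> v) n = f \<circ> polyline v n"
proof -
  have "linepath (f a) (f b) = f \<circ> linepath a b" for a b
    by (simp add: linepath_def fun_eq_iff linear_add[OF assms] linear_cmul[OF assms])
  then show ?thesis
    by (induction v n rule: polyline.induct) (simp_all add: path_compose_join)
qed

lemma ray_linear_image:
  assumes "linear f"
  shows "ray (f p) (f q) = f ` ray p q"
proof -
  have "f (p + t *\<^sub>R (q - p)) = f p + t *\<^sub>R (f q - f p)" for t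
    using assms by (simp add: linear_add linear_cmul linear_diff)
  then show ?thesis unfolding ray_def by (auto simp: image_iff) metis
qed

lemma staircase_line_reflect:
  assumes s: "s \<in> {1, -1}" and t: "t \<in> {1, -1}" and "staircase_line l"
  shows "staircase_line (reflect s t ` l)"
proof -
  let ?R = "reflect s t"
  obtain v n where v: "staircase_segment v n"
    and l: "l = ray (v 1) (v 0) \<union> (\<Union>i\<in>{1<..<n}. closed_segment (v (i - 1)) (v i)) \<union> ray (v (n - 1)) (v n)"
    using assms(3) unfolding staircase_line_def by blast
  have "inj ?R" by (metis injI reflect_reflect[OF s t])
  have sgnR: "sgn (?R p - ?R q) = ?R (sgn (p - q))" for p q
    by (simp add: sgn_div_norm norm_reflect[OF s t] flip: linear_diff[OF linear_reflect] linear_cmul[OF linear_reflect])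
  have step: "sgn ((?R \<circ> v) i - (?R \<circ> v) j) = ?R (sgn (v i - v j))" for i j
    by (simp add: sgnR)
  have aligned: "axis_aligned ((?R \<circ> v) i) ((?R \<circ> v) j)" if "axis_aligned (v i) (v j)" for i j
    using that injD[OF \<open>inj ?R\<close>] unfolding axis_aligned_def by auto
  have arc: "arc (polyline (?R \<circ> v) n)" if "arc (polyline v n)"
    unfolding polyline_linear_image[OF linear_reflect] arc_linear_image_eq[OF linear_reflect \<open>inj ?R\<close>]
    by (rule that)
  have "staircase_segment (?R \<circ> v) n"
    using v unfolding staircase_segment_def step
    by (elim conjE, intro conjI ballI impI arc aligned arg_cong[of _ _ ?R]) blast+
  moreover have "?R ` l = ray ((?R \<circ> v) 1) ((?R \<circ> v) 0)
      \<union> (\<Union>i\<in>{1<..<n}. closed_segment ((?R \<circ> v) (i - 1)) ((?R \<circ> v) i)) \<union> ray ((?R \<circ> v) (n - 1)) ((?R \<circ> v) n)"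
    unfolding l by (simp add: image_Un image_UN ray_linear_image[OF linear_reflect]
        closed_segment_linear_image[OF linear_reflect])
  ultimately show ?thesis unfolding staircase_line_def by blast
qed

lemma splits_reflect:
  assumes s: "s \<in> {1, -1}" and t: "t \<in> {1, -1}" and "splits l U L"
  shows "splits (reflect s t ` l) (reflect s t ` U) (reflect s t ` L)"
proof -
  let ?R = "reflect s t"
  have "bij ?R" by (rule involuntory_imp_bij) (rule reflect_reflect[OF s t])
  then have "open (?R ` S)" if "open S" for S
    using open_surjective_linear_image[OF that linear_reflect] bij_is_surj by blast
  moreover have "?R ` U \<inter> ?R ` L = ?R ` (U \<inter> L)" "- ?R ` l = ?R ` (- l)"
    using \<open>bij ?R\<close> by (simp_all add: image_Int bij_is_inj bij_image_Compl_eq)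
  ultimately show ?thesis
    using assms(3) unfolding splits_def by (auto simp: image_Un)
qed

section \<open>Strict separation by a staircase line\<close>

theorem theorem2:
  fixes A B :: "(real^2) set"
  assumes "compact A" and "path_connected A" and "ortho_convex A"
    and "compact B" and "path_connected B" and "ortho_convex B"
    and "A \<inter> B = {}"
  shows "\<exists>l. staircase_line l \<and> strictly_separates l A B"
proof -
  have conn: "connected A" "connected B"
    using assms path_connected_imp_connected by auto
  obtain s t :: real where s: "s \<in> {1, -1}" and t: "t \<in> {1, -1}"
    and avoid: "\<And>a b. a \<in> A \<Longrightarrow> b \<in> B \<Longrightarrow> \<not> (s * a $ 1 \<le> s * b $ 1 \<and> t * a $ 2 \<le> t * b $ 2)"
    using ortho_convex_sets_avoid_a_quadrant[of A B] assms conn by blast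
  let ?R = "reflect s t"
  have "compact (?R ` S)" if "compact S" for S
    using that by (intro compact_continuous_image linear_continuous_on)
      (simp_all add: linear_reflect flip: linear_conv_bounded_linear)
  then obtain l U L where l: "staircase_line l" "splits l U L" "?R ` A \<subseteq> U" "?R ` B \<subseteq> L"
    using staircase_between[of "?R ` A" "?R ` B"] assms(1,4) avoid by fastforce
  have pull_back: "S \<subseteq> ?R ` V" if "?R ` S \<subseteq> V" for S V
    using that reflect_reflect[OF s t] by (metis image_eqI image_subset_iff subsetI)
  have "strictly_separates (?R ` l) A B"
    by (rule strictly_separates_splits[OF splits_reflect[OF s t l(2)] conn(1) pull_back[OF l(3)]
          conn(2) pull_back[OF l(4)]])
  then show ?thesis
    using staircase_line_reflect[OF s t l(1)] by blast
qed

end
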